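(* Let $n=p_1p_2\cdots p_r$, where $r\geq 3$ and $p_1<p_2<\cdots<p_r$ are prime numbers. Then $\kappa(\mathcal{P}(C_n))= \min \{\alpha(n),\gamma(n)\}$, where $$\alpha(n)=\phi(n)+\frac{n}{p_1p_2\cdots p_r}\left[p_1p_2\cdots p_{r-1}-\phi(p_1p_2\cdots p_{r-1})\right],$$ $$\gamma(n)= \phi(n)+\frac{n}{p_1p_2\cdots p_r}\left[\phi(p_1\cdots p_{r-1})+ \phi(p_1\cdots p_{r-2}p_r)+p_1\cdots p_{r-2}-\phi(p_1\cdots p_{r-2})\right]$$ (here $\frac{n}{p_1p_2\cdots p_r}=1$).
   Context: $C_n$ is the cyclic group of order $n$ and $\phi$ is Euler's totient function. The power graph $\mathcal{P}(G)$ of a finite group $G$ is the simple undirected graph with vertex set $G$ in which two distinct vertices $x,y$ are adjacent if and only if $x\in\langle y\rangle$ or $y\in\langle x\rangle$. The vertex connectivity $\kappa(\Gamma)$ of a graph $\Gamma$ is the minimum number of vertices which need to be removed so that the induced subgraph on the remaining vertices is disconnected or has only one vertex. *)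

theory Defs
  imports
    "HOL-Number_Theory.Totient"
    "HOL-Algebra.Elementary_Groups"
    "Graph_Theory.Digraph_Component"
begin

text \<open>An undirected graph is a symmetric digraph: every edge contributes both of its orientations.\<close>

definition power_graph :: "('a, 'b) monoid_scheme \<Rightarrow> 'a pair_pre_digraph" where
  "power_graph G = \<lparr>
     pverts = carrier G,
     parcs = {(x, y). x \<in> carrier G \<and> y \<in> carrier G \<and> x \<noteq> y \<and>
                      (x \<in> generate G {y} \<or> y \<in> generate G {x})}\<rparr>"

lemma pair_graph_power_graph:
  assumes "finite (carrier G)"
  shows "pair_graph (power_graph G)"
proof
  have "parcs (power_graph G) \<subseteq> carrier G \<times> carrier G"
    by (auto simp: power_graph_def)
  then show "finite (parcs (power_graph G))"
    using assms by (meson finite_SigmaI finite_subset)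
  show "symmetric (with_proj (power_graph G))"
    by (auto simp: symmetric_def sym_def power_graph_def)
qed (use assms in \<open>auto simp: power_graph_def\<close>)

text \<open>
  Intended for finite undirected graphs. A graph without vertices is not connected in the sense of
  the library, so deleting all vertices is admitted below. For a nonempty graph this does not affect
  the minimum, since leaving exactly one vertex is always admitted and deletes fewer vertices.
\<close>

definition vertex_connectivity :: "('a, 'b) pre_digraph \<Rightarrow> nat" where
  "vertex_connectivity \<Gamma> =
     (LEAST k. \<exists>S. S \<subseteq> verts \<Gamma> \<and> card S = k \<and>
        (\<not> Digraph_Component.connected (\<Gamma> \<restriction> (verts \<Gamma> - S)) \<or> card (verts \<Gamma> - S) = 1))"

text \<open>
  The primes are \<open>p 1, \<dots>, p r\<close>. As \<open>totient m \<le> m\<close>, the subtractions on the naturals do not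
  truncate; the division is exact when the product of the primes divides \<open>n\<close>.
\<close>

definition alpha :: "(nat \<Rightarrow> nat) \<Rightarrow> nat \<Rightarrow> nat \<Rightarrow> nat" where
  "alpha p r n = totient n + n div (\<Prod>i=1..r. p i) *
     ((\<Prod>i=1..r-1. p i) - totient (\<Prod>i=1..r-1. p i))"

definition gamma :: "(nat \<Rightarrow> nat) \<Rightarrow> nat \<Rightarrow> nat \<Rightarrow> nat" where
  "gamma p r n = totient n + n div (\<Prod>i=1..r. p i) *
     (totient (\<Prod>i=1..r-1. p i) + totient ((\<Prod>i=1..r-2. p i) * p r) +
      ((\<Prod>i=1..r-2. p i) - totient (\<Prod>i=1..r-2. p i)))"

end

theory Submission
  imports Defs "HOL-Algebra.Multiplicative_Group"
begin

text \<open>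
  Send an element to the set of all \<open>i\<close> such that \<open>p i\<close> divides its order. This maps the group onto
  the Boolean lattice of subsets of \<open>{1..r}\<close>; elements are adjacent iff their sets are comparable, and the normalised counting
  measure becomes the product measure in which \<open>i\<close> is chosen with probability \<open>q i = 1 - 1 / p i\<close>.
  A cut is thus the complement of two nonempty families \<open>X\<close>, \<open>Y\<close> that are pairwise incomparable.

  Let \<open>u\<close> and \<open>d\<close> be the measures of the up-set and the down-set generated by \<open>X\<close>. By Harris'
  inequality the cut has measure at least \<open>u + d - 2ud\<close>, that is, \<open>(1 - (1 - 2u)(1 - 2d)) / 2\<close>, with
  equality when \<open>X\<close> is a single set. If \<open>u\<close> and \<open>d\<close> are both below \<open>1/2\<close> one may replace \<open>X\<close> by any one
  of its members, if both are above \<open>1/2\<close> one passes to a member of \<open>Y\<close>, and otherwise the bound is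
  at least \<open>1/2\<close>. Among single sets of size \<open>k\<close> the best one is \<open>{1..k}\<close>, and moving \<open>k\<close> upwards
  improves it until \<open>k = r - 2\<close>; the last two values of \<open>k\<close> give \<open>gamma\<close> and \<open>alpha\<close>.
  This suffices unless \<open>q 1 \<cdots> q (r - 1) > 1/2\<close>, in which case \<open>alpha\<close> is a lower
  bound by looking only at the sets \<open>{1..r} - {i}\<close>.
\<close>

section \<open>Product measures on the Boolean lattice\<close>

text \<open>The index set \<open>I\<close> is an argument because inductions enlarge it and because
  it gets split into the constrained and the free coordinates.\<close>

definition cube_weight :: "('i \<Rightarrow> real) \<Rightarrow> 'i set \<Rightarrow> 'i set \<Rightarrow> real" where
  "cube_weight q I A = (\<Prod>i\<in>A. q i) * (\<Prod>i\<in>I - A. 1 - q i)"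

definition cube_measure :: "('i \<Rightarrow> real) \<Rightarrow> 'i set \<Rightarrow> 'i set set \<Rightarrow> real" where
  "cube_measure q I F = (\<Sum>A\<in>F. cube_weight q I A)"

lemma cube_weight_nonneg:
  assumes "\<And>i. i \<in> I \<Longrightarrow> 0 \<le> q i \<and> q i \<le> 1" "A \<subseteq> I"
  shows "0 \<le> cube_weight q I A"
  unfolding cube_weight_def using assms by (intro mult_nonneg_nonneg prod_nonneg) auto

lemma cube_measure_mono:
  assumes "finite I" "\<And>i. i \<in> I \<Longrightarrow> 0 \<le> q i \<and> q i \<le> 1" "E \<subseteq> F" "F \<subseteq> Pow I"
  shows "cube_measure q I E \<le> cube_measure q I F"
  unfolding cube_measure_def
  using assms by (intro sum_mono2 cube_weight_nonneg) (auto intro: finite_subset)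

lemma cube_measure_Un_Int:
  assumes "finite I" "E \<subseteq> Pow I" "F \<subseteq> Pow I"
  shows "cube_measure q I (E \<union> F) + cube_measure q I (E \<inter> F) = cube_measure q I E + cube_measure q I F"
proof -
  have "finite E" "finite F"
    using assms by (auto intro: finite_subset)
  then show ?thesis
    unfolding cube_measure_def by (rule sum.union_inter)
qed

lemma cube_measure_Diff:
  assumes "finite I" "E \<subseteq> F" "F \<subseteq> Pow I"
  shows "cube_measure q I (F - E) = cube_measure q I F - cube_measure q I E"
  unfolding cube_measure_def using assms by (intro sum_diff) (auto intro: finite_subset)

lemma cube_measure_insert:
  assumes "finite I" "F \<subseteq> Pow I" "A \<subseteq> I" "A \<notin> F"
  shows "cube_measure q I (insert A F) = cube_weight q I A + cube_measure q I F"
  unfolding cube_measure_def using assms by (intro sum.insert) (auto intro: finite_subset)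

text \<open>Conditioning on whether \<open>i\<close> is chosen. The integrand \<open>f\<close> is
  arbitrary so that one step serves both the total mass and the correlation inequality.\<close>

lemma sum_cube_weight_insert:
  assumes "finite I" "i \<notin> I"
  shows "(\<Sum>A\<in>Pow (insert i I). cube_weight q (insert i I) A * f A) =
    (1 - q i) * (\<Sum>A\<in>Pow I. cube_weight q I A * f A) +
    q i * (\<Sum>A\<in>Pow I. cube_weight q I A * f (insert i A))"
proof -
  have inj: "inj_on (insert i) (Pow I)"
    using assms by (auto simp: inj_on_def)
  have "(\<Sum>A\<in>Pow (insert i I). cube_weight q (insert i I) A * f A) =
    (\<Sum>A\<in>Pow I. cube_weight q (insert i I) A * f A) +
    (\<Sum>A\<in>insert i ` Pow I. cube_weight q (insert i I) A * f A)"
    unfolding Pow_insert using assms by (intro sum.union_disjoint) auto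
  also have "(\<Sum>A\<in>insert i ` Pow I. cube_weight q (insert i I) A * f A) =
    (\<Sum>A\<in>Pow I. cube_weight q (insert i I) (insert i A) * f (insert i A))"
    using inj by (simp add: sum.reindex)
  also have "\<dots> = q i * (\<Sum>A\<in>Pow I. cube_weight q I A * f (insert i A))"
    unfolding sum_distrib_left
  proof (rule sum.cong)
    fix A assume "A \<in> Pow I"
    then have "finite A" "i \<notin> A" "insert i I - insert i A = I - A"
      using assms by (auto intro: finite_subset)
    then show "cube_weight q (insert i I) (insert i A) * f (insert i A) = q i * (cube_weight q I A * f (insert i A))"
      by (simp add: cube_weight_def)
  qed simp
  also have "(\<Sum>A\<in>Pow I. cube_weight q (insert i I) A * f A) =
    (1 - q i) * (\<Sum>A\<in>Pow I. cube_weight q I A * f A)"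
    unfolding sum_distrib_left
  proof (rule sum.cong)
    fix A assume "A \<in> Pow I"
    then have "insert i I - A = insert i (I - A)" "i \<notin> I - A" "finite (I - A)"
      using assms by auto
    then show "cube_weight q (insert i I) A * f A = (1 - q i) * (cube_weight q I A * f A)"
      by (simp add: cube_weight_def)
  qed simp
  finally show ?thesis .
qed

lemma sum_cube_weight:
  assumes "finite I"
  shows "(\<Sum>A\<in>Pow I. cube_weight q I A) = 1"
  using assms
proof (induction I rule: finite_induct)
  case empty
  then show ?case by (simp add: cube_weight_def)
next
  case (insert i I)
  then show ?case
    using sum_cube_weight_insert[of I i q "\<lambda>_. 1"] by simp
qed

lemma cube_measure_Pow_self:
  assumes "finite I"
  shows "cube_measure q I (Pow I) = 1"
  using sum_cube_weight[OF assms] by (simp add: cube_measure_def)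

text \<open>Only the coordinates outside \<open>A\<close> are constrained; the free ones inside
  \<open>A\<close> contribute total mass 1. \<open>cube_measure_up\<close> is the dual case.\<close>

lemma cube_measure_Pow:
  assumes "finite I" "A \<subseteq> I"
  shows "cube_measure q I (Pow A) = (\<Prod>i\<in>I - A. 1 - q i)"
proof -
  have fin: "finite A"
    using assms finite_subset by blast
  have "cube_weight q I B = cube_weight q A B * (\<Prod>i\<in>I - A. 1 - q i)" if "B \<in> Pow A" for B
  proof -
    have "I - B = (A - B) \<union> (I - A)"
      using that assms by auto
    then have "(\<Prod>i\<in>I - B. 1 - q i) = (\<Prod>i\<in>A - B. 1 - q i) * (\<Prod>i\<in>I - A. 1 - q i)"
      using assms fin by (subst prod.union_disjoint[symmetric]) auto
    then show ?thesis
      by (simp add: cube_weight_def)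
  qed
  then have "cube_measure q I (Pow A) = (\<Sum>B\<in>Pow A. cube_weight q A B) * (\<Prod>i\<in>I - A. 1 - q i)"
    unfolding cube_measure_def sum_distrib_right by (intro sum.cong) auto
  then show ?thesis
    using sum_cube_weight[OF fin] by simp
qed

lemma cube_measure_up:
  assumes "finite I" "A \<subseteq> I"
  shows "cube_measure q I {B. A \<subseteq> B \<and> B \<subseteq> I} = (\<Prod>i\<in>A. q i)"
proof -
  have fin: "finite A" "finite (I - A)"
    using assms finite_subset by auto
  have eq: "{B. A \<subseteq> B \<and> B \<subseteq> I} = (\<union>) A ` Pow (I - A)"
  proof (intro equalityI subsetI)
    fix B assume "B \<in> {B. A \<subseteq> B \<and> B \<subseteq> I}"
    then have "B = A \<union> (B - A)" "B - A \<in> Pow (I - A)" by auto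
    then show "B \<in> (\<union>) A ` Pow (I - A)" by blast
  qed (use assms in auto)
  have inj: "inj_on ((\<union>) A) (Pow (I - A))"
    by (auto simp: inj_on_def)
  have "cube_weight q I (A \<union> B) = (\<Prod>i\<in>A. q i) * cube_weight q (I - A) B" if "B \<in> Pow (I - A)" for B
  proof -
    have "I - (A \<union> B) = I - A - B" "finite B" "A \<inter> B = {}"
      using that fin finite_subset by auto
    then show ?thesis
      using fin by (simp add: cube_weight_def prod.union_disjoint)
  qed
  then have "cube_measure q I {B. A \<subseteq> B \<and> B \<subseteq> I} =
    (\<Prod>i\<in>A. q i) * (\<Sum>B\<in>Pow (I - A). cube_weight q (I - A) B)"
    unfolding cube_measure_def eq sum_distrib_left sum.reindex[OF inj] by (intro sum.cong) auto
  then show ?thesis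
    using sum_cube_weight[OF fin(2)] by simp
qed

text \<open>Condition on one coordinate \<open>i\<close>: the induction hypothesis handles the two
  halves, and Chebyshev's inequality on a two-point space combines them.\<close>

lemma harris_inequality:
  fixes f g :: "'i set \<Rightarrow> real"
  assumes "finite I" "\<And>i. i \<in> I \<Longrightarrow> 0 \<le> q i \<and> q i \<le> 1"
    and "\<And>A B. A \<subseteq> B \<Longrightarrow> B \<subseteq> I \<Longrightarrow> f A \<le> f B"
    and "\<And>A B. A \<subseteq> B \<Longrightarrow> B \<subseteq> I \<Longrightarrow> g B \<le> g A"
  shows "(\<Sum>A\<in>Pow I. cube_weight q I A * (f A * g A)) \<le>
    (\<Sum>A\<in>Pow I. cube_weight q I A * f A) * (\<Sum>A\<in>Pow I. cube_weight q I A * g A)"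
  using assms
proof (induction I arbitrary: f g rule: finite_induct)
  case empty
  then show ?case by (simp add: cube_weight_def)
next
  case (insert i I)
  define E where "E h = (\<Sum>A\<in>Pow I. cube_weight q I A * h A)" for h
  have E_mono: "E h \<le> E k" if "\<And>A. A \<subseteq> I \<Longrightarrow> h A \<le> k A" for h k
    unfolding E_def using that insert.prems(1)
    by (intro sum_mono mult_left_mono cube_weight_nonneg) auto
  let ?f = "\<lambda>A. f (insert i A)" and ?g = "\<lambda>A. g (insert i A)"
  have q: "0 \<le> q i" "q i \<le> 1"
    using insert.prems(1) by auto
  have f: "E f \<le> E ?f"
    by (intro E_mono insert.prems(2)) auto
  have g: "E ?g \<le> E g"
    by (intro E_mono insert.prems(3)) auto
  have "E (\<lambda>A. f A * g A) \<le> E f * E g"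
    unfolding E_def by (intro insert.IH insert.prems(2,3)) (use insert.prems(1) in auto)
  moreover have "E (\<lambda>A. ?f A * ?g A) \<le> E ?f * E ?g"
    unfolding E_def by (intro insert.IH insert.prems(2,3)) (use insert.prems(1) in auto)
  ultimately have "(1 - q i) * E (\<lambda>A. f A * g A) + q i * E (\<lambda>A. ?f A * ?g A) \<le>
    (1 - q i) * (E f * E g) + q i * (E ?f * E ?g)"
    using q by (intro add_mono mult_left_mono) auto
  also have "\<dots> \<le> ((1 - q i) * E f + q i * E ?f) * ((1 - q i) * E g + q i * E ?g)"
  proof -
    \<comment> \<open>This product is exactly the right side minus the left side.\<close>
    have "0 \<le> (q i * (1 - q i)) * ((E ?f - E f) * (E g - E ?g))"
      using q f g by (intro mult_nonneg_nonneg) auto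
    then show ?thesis by (simp add: algebra_simps)
  qed
  finally show ?case
    using insert.hyps unfolding E_def
    by (simp add: sum_cube_weight_insert)
qed

text \<open>Harris' inequality for indicator functions: that of an up-set is increasing, that of a
  down-set decreasing.\<close>

lemma cube_measure_up_down_le:
  assumes I: "finite I" and q: "\<And>i. i \<in> I \<Longrightarrow> 0 \<le> q i \<and> q i \<le> 1"
    and UD: "U \<subseteq> Pow I" "D \<subseteq> Pow I"
    and U: "\<And>A B. A \<in> U \<Longrightarrow> A \<subseteq> B \<Longrightarrow> B \<subseteq> I \<Longrightarrow> B \<in> U"
    and D: "\<And>A B. B \<in> D \<Longrightarrow> A \<subseteq> B \<Longrightarrow> A \<in> D"
  shows "cube_measure q I (U \<inter> D) \<le> cube_measure q I U * cube_measure q I D"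
proof -
  have eq: "cube_measure q I F = (\<Sum>A\<in>Pow I. cube_weight q I A * of_bool (A \<in> F))" if "F \<subseteq> Pow I" for F
  proof -
    have "(\<Sum>A\<in>F. cube_weight q I A) = (\<Sum>A\<in>Pow I. if A \<in> F then cube_weight q I A else 0)"
      using that I by (simp add: sum.If_cases Int_absorb1)
    also have "\<dots> = (\<Sum>A\<in>Pow I. cube_weight q I A * of_bool (A \<in> F))"
      by (intro sum.cong) auto
    finally show ?thesis
      unfolding cube_measure_def .
  qed
  have "U \<inter> D \<subseteq> Pow I" using UD by auto
  then have "cube_measure q I (U \<inter> D) =
      (\<Sum>A\<in>Pow I. cube_weight q I A * (of_bool (A \<in> U) * of_bool (A \<in> D)))"
    by (simp add: eq of_bool_conj)
  also have "\<dots> \<le> cube_measure q I U * cube_measure q I D"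
    unfolding eq[OF UD(1)] eq[OF UD(2)]
    by (rule harris_inequality[OF I q]) (use U D in auto)
  finally show ?thesis .
qed

section \<open>Families of pairwise incomparable sets\<close>

text \<open>In terms of \<open>1 - 2 * x\<close> the bound \<open>u + d - 2 * u * d\<close>
  factorises, so sets can be compared factor by factor once the signs agree. The strict bounds by
  \<open>1 / 2\<close> record that both factors are positive.\<close>

lemma cross_incomparable_complement:
  fixes q :: "'i \<Rightarrow> real"
  assumes I: "finite I" and q: "\<And>i. i \<in> I \<Longrightarrow> 0 \<le> q i \<and> q i \<le> 1"
    and XY: "X \<subseteq> Pow I" "Y \<subseteq> Pow I" "X \<noteq> {}" "Y \<noteq> {}"
    and incomp: "\<And>A B. A \<in> X \<Longrightarrow> B \<in> Y \<Longrightarrow> \<not> A \<subseteq> B \<and> \<not> B \<subseteq> A"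
  obtains "1 / 2 \<le> cube_measure q I (Pow I - (X \<union> Y))"
  | A where "A \<subseteq> I" "A \<noteq> {}" "A \<noteq> I" "(\<Prod>i\<in>A. q i) < 1 / 2" "(\<Prod>i\<in>I - A. 1 - q i) < 1 / 2"
      "(1 - 2 * cube_measure q I (Pow I - (X \<union> Y))) \<le> (1 - 2 * (\<Prod>i\<in>A. q i)) * (1 - 2 * (\<Prod>i\<in>I - A. 1 - q i))"
proof -
  define U where "U = {B. B \<subseteq> I \<and> (\<exists>A\<in>X. A \<subseteq> B)}"
  define D where "D = {B. \<exists>A\<in>X. B \<subseteq> A}"
  let ?m = "cube_measure q I"
  define a where "a A = (\<Prod>i\<in>A. q i)" for A
  define b where "b A = (\<Prod>i\<in>I - A. 1 - q i)" for A
  have UD: "U \<subseteq> Pow I" "D \<subseteq> Pow I"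
    using XY by (auto simp: U_def D_def)
  have mono: "?m E \<le> ?m F" if "E \<subseteq> F" "F \<subseteq> Pow I" for E F
    using cube_measure_mono[of I q E F] I q that by blast
  have up: "?m {B. A \<subseteq> B \<and> B \<subseteq> I} = a A" if "A \<subseteq> I" for A
    using cube_measure_up[OF I that] by (simp add: a_def)
  have down: "?m (Pow A) = b A" if "A \<subseteq> I" for A
    using cube_measure_Pow[OF I that] by (simp add: b_def)
  have compl: "?m (Pow I - F) = 1 - ?m F" if "F \<subseteq> Pow I" for F
    using cube_measure_Diff[OF I that, of q] cube_measure_Pow_self[OF I] by simp
  have "?m (U \<inter> D) \<le> ?m U * ?m D"
  proof (rule cube_measure_up_down_le[OF I q UD])
    show "B \<in> U" if "A \<in> U" "A \<subseteq> B" "B \<subseteq> I" for A B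
      using that unfolding U_def by blast
    show "A \<in> D" if "B \<in> D" "A \<subseteq> B" for A B
      using that unfolding D_def by blast
  qed
  moreover have "?m (U \<union> D) + ?m (U \<inter> D) = ?m U + ?m D"
    using cube_measure_Un_Int[OF I UD] .
  moreover have "?m ((U \<union> D) - (U \<inter> D)) = ?m (U \<union> D) - ?m (U \<inter> D)"
    using UD by (intro cube_measure_Diff[OF I]) auto
  moreover have "?m ((U \<union> D) - (U \<inter> D)) \<le> ?m (Pow I - (X \<union> Y))"
  proof (rule mono)
    \<comment> \<open>A member of \<open>Y\<close> is neither above nor below a member of
      \<open>X\<close>, so the symmetric difference of \<open>U\<close> and \<open>D\<close> avoids
      both families.\<close>
    have "X \<subseteq> U \<inter> D" "Y \<inter> (U \<union> D) = {}"
      using incomp XY by (fastforce simp: U_def D_def)+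
    then show "(U \<union> D) - (U \<inter> D) \<subseteq> Pow I - (X \<union> Y)"
      using UD by blast
  qed auto
  \<comment> \<open>The symmetric difference has measure
    \<open>?m U + ?m D - 2 * ?m (U \<inter> D)\<close>; the last term is bounded by the correlation
    inequality.\<close>
  ultimately have main: "1 - 2 * ?m (Pow I - (X \<union> Y)) \<le> (1 - 2 * ?m U) * (1 - 2 * ?m D)"
    by (simp add: algebra_simps)
  obtain A where A: "A \<in> X" using XY by auto
  obtain B where B: "B \<in> Y" using XY by auto
  have sub: "A \<subseteq> I" "B \<subseteq> I" using A B XY by auto
  have ne: "A \<noteq> {}" "A \<noteq> I" "B \<noteq> {}" "B \<noteq> I"
    using incomp[OF A B] sub by auto
  have U_ge: "a A \<le> ?m U"
    unfolding up[OF sub(1), symmetric] using UD A by (intro mono) (auto simp: U_def)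
  have D_ge: "b A \<le> ?m D"
    unfolding down[OF sub(1), symmetric] using UD A by (intro mono) (auto simp: D_def)
  \<comment> \<open>For \<open>B\<close> in \<open>Y\<close> the roles are swapped: no subset of
    \<open>B\<close> is in \<open>U\<close> and no superset is in \<open>D\<close>.\<close>
  have "Pow B \<subseteq> Pow I - U"
    using incomp[OF _ B] sub unfolding U_def by blast
  then have U_le: "b B \<le> 1 - ?m U"
    unfolding down[OF sub(2), symmetric] compl[OF UD(1), symmetric] by (rule mono) auto
  have "{A. B \<subseteq> A \<and> A \<subseteq> I} \<subseteq> Pow I - D"
    using incomp[OF _ B] sub unfolding D_def by blast
  then have D_le: "a B \<le> 1 - ?m D"
    unfolding up[OF sub(2), symmetric] compl[OF UD(2), symmetric] by (rule mono) auto
  consider (low) "?m U < 1 / 2" "?m D < 1 / 2" | (high) "?m U > 1 / 2" "?m D > 1 / 2"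
    | (mixed) "(1 - 2 * ?m U) * (1 - 2 * ?m D) \<le> 0"
    unfolding mult_le_0_iff by linarith
  then show ?thesis
  proof cases
    case low
    have "(1 - 2 * ?m U) * (1 - 2 * ?m D) \<le> (1 - 2 * a A) * (1 - 2 * b A)"
      using low U_ge D_ge by (intro mult_mono) auto
    then show ?thesis
      using that(2)[of A] low U_ge D_ge main sub ne unfolding a_def b_def by auto
  next
    case high
    \<comment> \<open>Both factors are negative; flipping both signs passes to the complementary
      measures, which are at least \<open>b B\<close> and \<open>a B\<close>.\<close>
    have "(1 - 2 * ?m U) * (1 - 2 * ?m D) = (1 - 2 * (1 - ?m D)) * (1 - 2 * (1 - ?m U))"
      by (simp add: algebra_simps)
    also have "\<dots> \<le> (1 - 2 * a B) * (1 - 2 * b B)"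
      using high U_le D_le by (intro mult_mono) auto
    finally show ?thesis
      using that(2)[of B] high U_le D_le main sub ne unfolding a_def b_def by auto
  next
    case mixed
    then show ?thesis
      using that(1) main by auto
  qed
qed

text \<open>The bound is the measure of the cut isolating \<open>I - {r}\<close>: above it lies only
  \<open>I\<close>, below it its proper subsets. The proof asks which of the families contain the
  coatoms \<open>I - {i}\<close>.\<close>

lemma cross_incomparable_complement_large:
  fixes q :: "'i \<Rightarrow> real"
  assumes I: "finite I" and q: "\<And>i. i \<in> I \<Longrightarrow> 0 < q i \<and> q i \<le> 1"
    and r: "r \<in> I" "\<And>i. i \<in> I \<Longrightarrow> q i \<le> q r"
    and half: "1 / 2 \<le> (\<Prod>i\<in>I - {r}. q i)"
    and XY: "X \<subseteq> Pow I" "Y \<subseteq> Pow I" "X \<noteq> {}" "Y \<noteq> {}"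
    and incomp: "\<And>A B. A \<in> X \<Longrightarrow> B \<in> Y \<Longrightarrow> \<not> A \<subseteq> B \<and> \<not> B \<subseteq> A"
  shows "(\<Prod>i\<in>I. q i) + (1 - q r) * (1 - (\<Prod>i\<in>I - {r}. q i)) \<le> cube_measure q I (Pow I - (X \<union> Y))"
proof -
  let ?m = "cube_measure q I" and ?C = "Pow I - (X \<union> Y)"
  define a where "a = (\<Prod>i\<in>I - {r}. q i)"
  define P where "P = (\<Prod>i\<in>I. q i)"
  have q': "\<And>i. i \<in> I \<Longrightarrow> 0 \<le> q i \<and> q i \<le> 1"
    using q by (simp add: less_imp_le)
  have P: "P = q r * a"
    unfolding P_def a_def using I r by (simp add: prod.remove)
  have "0 < a" "a \<le> 1" "1 / 2 \<le> a"
    unfolding a_def using q half by (auto intro!: prod_pos prod_le_1 simp: less_imp_le)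
  have top: "cube_weight q I I = P"
    by (simp add: cube_weight_def P_def)
  have mono: "?m E \<le> ?m F" if "E \<subseteq> F" "F \<subseteq> Pow I" for E F
    using cube_measure_mono[of I q E F] I q' that by blast
  have "I \<notin> X"
    using XY(2,4) incomp[of I] by blast
  moreover have "I \<notin> Y"
    using XY(1,3) incomp[of _ I] by blast
  ultimately have I_mem: "I \<in> ?C" by simp
  have disj: "X \<inter> Y = {}"
    using incomp by blast
  show ?thesis
  proof (cases "\<exists>i\<in>I. I - {i} \<in> ?C")
    \<comment> \<open>a coatom in the complement is already heavy enough\<close>
    case True
    then obtain i where i: "i \<in> I" "I - {i} \<in> ?C" by blast
    have "?m {I, I - {i}} \<le> ?m ?C"
      using i I_mem by (intro mono) auto
    moreover have "?m {I, I - {i}} = P + cube_weight q I (I - {i})"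
    proof -
      have "I \<noteq> I - {i}" using i by blast
      then show ?thesis by (simp add: cube_measure_def top)
    qed
    moreover have "cube_weight q I (I - {i}) = (1 - q i) * (\<Prod>j\<in>I - {i}. q j)"
      using i by (simp add: cube_weight_def double_diff)
    \<comment> \<open>Omitting the largest factor \<open>q r\<close> gives the smallest product over
      a coatom, so every such product is at least \<open>a\<close>, and \<open>a\<close> is at least
      \<open>1 - a\<close> by \<open>half\<close>.\<close>
    moreover have "(1 - q r) * (1 - a) \<le> (1 - q i) * (\<Prod>j\<in>I - {i}. q j)"
    proof (intro mult_mono)
      have "q i * (\<Prod>j\<in>I - {i}. q j) = q r * a"
        using P I i by (simp add: P_def prod.remove)
      moreover have "q i * a \<le> q r * a"
        using r i \<open>0 < a\<close> by simp
      ultimately have "q i * a \<le> q i * (\<Prod>j\<in>I - {i}. q j)" by simp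
      then have "a \<le> (\<Prod>j\<in>I - {i}. q j)"
        using q i by simp
      then show "1 - a \<le> (\<Prod>j\<in>I - {i}. q j)"
        using \<open>1 / 2 \<le> a\<close> by simp
    qed (use r i q \<open>a \<le> 1\<close> in auto)
    ultimately show ?thesis
      by (simp add: P_def a_def)
  next
    \<comment> \<open>the coatoms split into \<open>X\<close> and \<open>Y\<close>, so a set missing an element of both parts lies in neither family\<close>
    case False
    define J where "J = {i \<in> I. I - {i} \<in> X}"
    define K where "K = {i \<in> I. I - {i} \<in> Y}"
    have JK: "J \<subseteq> I" "K \<subseteq> I" "J \<union> K = I" "J \<inter> K = {}"
      using False disj by (auto simp: J_def K_def)
    have "finite J" "finite K"
      using JK I finite_subset by auto
    have ex: "\<exists>i\<in>I. A \<subseteq> I - {i}" if "A \<subseteq> I" "A \<noteq> I" for A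
      using that by blast
    \<comment> \<open>If \<open>K\<close> were empty, all coatoms would be in \<open>X\<close>, and
      any member of \<open>Y\<close> lies below some coatom.\<close>
    have K_ne: "K \<noteq> {}"
    proof
      assume "K = {}"
      obtain B where "B \<in> Y" using XY by auto
      then have "B \<subseteq> I" "B \<noteq> I"
        using XY I_mem by auto
      then obtain i where "i \<in> I" "B \<subseteq> I - {i}"
        using ex by blast
      then show False
        using \<open>K = {}\<close> JK incomp \<open>B \<in> Y\<close> unfolding J_def by blast
    qed
    have J_ne: "J \<noteq> {}"
    proof
      assume "J = {}"
      obtain A where "A \<in> X" using XY by auto
      then have "A \<subseteq> I" "A \<noteq> I"
        using XY I_mem by auto
      then obtain i where "i \<in> I" "A \<subseteq> I - {i}"
        using ex by blast
      then show False
        using \<open>J = {}\<close> JK incomp \<open>A \<in> X\<close> unfolding K_def by blast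
    qed
    define V where "V S = {B. S \<subseteq> B \<and> B \<subseteq> I}" for S
    have V: "V J \<subseteq> Pow I" "V K \<subseteq> Pow I" "V J \<union> V K \<subseteq> Pow I" "V J \<inter> V K = {I}"
      using JK by (auto simp: V_def)
    have "insert I (Pow I - (V J \<union> V K)) \<subseteq> ?C"
    proof -
      have "j \<in> A" if "A \<in> Y" "j \<in> J" for A j
      proof (rule ccontr)
        assume "j \<notin> A"
        then have "A \<subseteq> I - {j}" using XY(2) \<open>A \<in> Y\<close> by auto
        then show False using incomp that by (auto simp: J_def)
      qed
      then have "Y \<subseteq> V J"
        using XY(2) by (auto simp: V_def)
      moreover have "k \<in> A" if "A \<in> X" "k \<in> K" for A k
      proof (rule ccontr)
        assume "k \<notin> A"
        then have "A \<subseteq> I - {k}" using XY(1) \<open>A \<in> X\<close> by auto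
        then show False using incomp that by (auto simp: K_def)
      qed
      then have "X \<subseteq> V K"
        using XY(1) by (auto simp: V_def)
      ultimately show ?thesis
        using I_mem by blast
    qed
    then have "?m (insert I (Pow I - (V J \<union> V K))) \<le> ?m ?C"
      by (intro mono) auto
    moreover have "?m (insert I (Pow I - (V J \<union> V K))) = P + ?m (Pow I - (V J \<union> V K))"
      using JK by (subst cube_measure_insert[OF I]) (auto simp: V_def top)
    moreover have "?m (Pow I - (V J \<union> V K)) = 1 - ?m (V J \<union> V K)"
      using cube_measure_Diff[OF I V(3), of q] cube_measure_Pow_self[OF I] by simp
    moreover have "?m (V J \<union> V K) + P = (\<Prod>i\<in>J. q i) + (\<Prod>i\<in>K. q i)"
      using cube_measure_Un_Int[OF I V(1,2), of q] V(4) cube_measure_up[OF I JK(1), of q]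
        cube_measure_up[OF I JK(2), of q] top
      by (simp add: V_def cube_measure_def)
    \<comment> \<open>Two numbers at most \<open>q r\<close> whose product is fixed at
      \<open>q r * a\<close> have the largest sum when one of them equals
      \<open>q r\<close>.\<close>
    moreover have "(\<Prod>i\<in>J. q i) + (\<Prod>i\<in>K. q i) \<le> q r + a"
    proof -
      have le: "(\<Prod>i\<in>S. q i) \<le> q r" if "S \<subseteq> I" "S \<noteq> {}" for S
      proof -
        obtain i where i: "i \<in> S" using \<open>S \<noteq> {}\<close> by blast
        have "(\<Prod>i\<in>S. q i) = q i * (\<Prod>i\<in>S - {i}. q i)"
          using i that I finite_subset by (metis prod.remove)
        also have "\<dots> \<le> q i * 1"
          using i that q by (intro mult_left_mono prod_le_1) (auto simp: less_imp_le subset_iff)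
        also have "\<dots> \<le> q r" using i that r by auto
        finally show ?thesis .
      qed
      have "P = (\<Prod>i\<in>J. q i) * (\<Prod>i\<in>K. q i)"
        using JK \<open>finite J\<close> \<open>finite K\<close> by (metis P_def prod.union_disjoint)
      moreover have "0 \<le> (q r - (\<Prod>i\<in>J. q i)) * (q r - (\<Prod>i\<in>K. q i))"
        using le JK J_ne K_ne by (intro mult_nonneg_nonneg) auto
      ultimately have "q r * ((\<Prod>i\<in>J. q i) + (\<Prod>i\<in>K. q i)) \<le> q r * (q r + a)"
        using P by (simp add: algebra_simps)
      then show ?thesis
        using q r by simp
    qed
    \<comment> \<open>The bound obtained is \<open>1 + 2 * P - q r - a\<close>, which is the claimed
      one because \<open>P = q r * a\<close>.\<close>
    ultimately show ?thesis
      using P unfolding P_def[symmetric] a_def[symmetric] by (simp add: algebra_simps)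
  qed
qed

section \<open>Optimising over single sets\<close>

text \<open>The \<open>j\<close>-th smallest element of \<open>A\<close> is at least
  \<open>j\<close>, so the factors compare one by one; the induction splits off the largest
  index.\<close>

lemma prod_atLeastAtMost_card_le:
  fixes f :: "nat \<Rightarrow> real"
  assumes "mono_on {1..r} f" "\<And>i. i \<in> {1..r} \<Longrightarrow> 0 \<le> f i" "A \<subseteq> {1..r}"
  shows "(\<Prod>i=1..card A. f i) \<le> (\<Prod>i\<in>A. f i)"
  using assms
proof (induction r arbitrary: A)
  case 0
  then show ?case by simp
next
  case (Suc r)
  have IH: "(\<Prod>i=1..card B. f i) \<le> (\<Prod>i\<in>B. f i)" if "B \<subseteq> {1..r}" for B
    using Suc.prems that by (intro Suc.IH) (auto intro: mono_on_subset)
  have fin: "finite A"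
    using Suc.prems finite_subset by blast
  have card: "card A \<le> Suc r"
    using card_mono[OF _ Suc.prems(3)] by simp
  show ?case
  proof (cases "Suc r \<in> A")
    case True
    define B where "B = A - {Suc r}"
    have cardA: "card A = Suc (card B)"
      unfolding B_def by (rule card.remove[OF fin True])
    have prodA: "(\<Prod>i\<in>A. f i) = f (Suc r) * (\<Prod>i\<in>B. f i)"
      unfolding B_def by (rule prod.remove[OF fin True])
    have "B \<subseteq> {1..r}"
      using Suc.prems(3) by (fastforce simp: B_def)
    moreover have "f (card A) \<le> f (Suc r)"
      using Suc.prems(1) card cardA by (auto simp: mono_on_def)
    ultimately have "f (card A) * (\<Prod>i=1..card B. f i) \<le> f (Suc r) * (\<Prod>i\<in>B. f i)"
      using Suc.prems(2) card cardA by (intro mult_mono IH prod_nonneg) auto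
    then show ?thesis
      unfolding prodA cardA by (simp add: mult.commute)
  next
    case False
    have "i \<in> {1..r}" if "i \<in> A" for i
      using that Suc.prems(3) False by (metis atLeastAtMost_iff le_Suc_eq subsetD)
    then show ?thesis
      by (intro IH) auto
  qed
qed

text \<open>
  Here \<open>t = 1 / p (k + 1)\<close>, while \<open>a\<close> and \<open>b\<close> are the measures of the up-set and the down-set of
  \<open>{1..k + 1}\<close>; dividing \<open>a\<close> by \<open>1 - t\<close> and multiplying \<open>b\<close> by \<open>t\<close> gives those of \<open>{1..k}\<close>.
\<close>

lemma defect_step:
  fixes a b t :: real
  assumes "0 < t" "t \<le> 1 / 2" "t \<le> a" "0 \<le> b" "b \<le> t\<^sup>2"
  shows "(1 - 2 * (a / (1 - t))) * (1 - 2 * (b * t)) \<le> (1 - 2 * a) * (1 - 2 * b)"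
proof -
  have "b * t \<le> (1/2)\<^sup>2 * (1/2)"
    using assms by (intro mult_mono order_trans[OF assms(5)] power_mono) auto
  then have bt: "0 \<le> 1 - 2 * (b * t)"
    by (simp add: power2_eq_square)
  \<comment> \<open>Replacing \<open>1 / (1 - t)\<close> by the smaller \<open>1 + t\<close> makes
    the inequality polynomial; it only enlarges the left side of the goal, as the other factor is
    nonnegative.\<close>
  have "a * (1 + t) \<le> a / (1 - t)"
    using assms by (simp add: field_simps)
  then have "(1 - 2 * (a / (1 - t))) * (1 - 2 * (b * t)) \<le> (1 - 2 * (a * (1 + t))) * (1 - 2 * (b * t))"
    using bt by (intro mult_right_mono) auto
  also have "\<dots> \<le> (1 - 2 * a) * (1 - 2 * b)"
  proof -
    \<comment> \<open>After expansion the goal is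
      \<open>b * (1 - t) * (1 - 2 * a) \<le> t * (a * (1 - 2 * (b * t)))\<close>. The left side
      decreases and the right side increases with \<open>a\<close>, so the worst case is
      \<open>a = t\<close>.\<close>
    have "b * (1 - t) * (1 - 2 * a) \<le> b * (1 - t) * (1 - 2 * t)"
      using assms by (intro mult_left_mono) auto
    \<comment> \<open>Collecting the terms with \<open>b\<close>, it remains to multiply
      \<open>b \<le> t\<^sup>2\<close> by a factor that is at most 1 for
      \<open>t \<le> 1 / 2\<close>.\<close>
    also have "\<dots> \<le> t\<^sup>2 - 2 * b * t ^ 3"
    proof -
      have "t\<^sup>2 \<le> (1/2)\<^sup>2"
        using assms by (intro power_mono) auto
      then have "t * (2 * t + 2 * t\<^sup>2) \<le> t * 3"
        using assms by (intro mult_left_mono) (auto simp: power2_eq_square)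
      then have "b * ((1 - t) * (1 - 2 * t) + 2 * t ^ 3) \<le> t\<^sup>2 * 1"
      proof (intro mult_mono)
        show "(1 - t) * (1 - 2 * t) + 2 * t ^ 3 \<le> 1"
          using \<open>t * (2 * t + 2 * t\<^sup>2) \<le> t * 3\<close>
          by (simp add: algebra_simps power2_eq_square power3_eq_cube)
        show "0 \<le> (1 - t) * (1 - 2 * t) + 2 * t ^ 3"
          using assms by (intro add_nonneg_nonneg mult_nonneg_nonneg) auto
      qed (use assms in auto)
      then show ?thesis by (simp add: algebra_simps)
    qed
    also have "\<dots> = t * (t * (1 - 2 * (b * t)))"
      by (simp add: algebra_simps power2_eq_square power3_eq_cube)
    also have "\<dots> \<le> t * (a * (1 - 2 * (b * t)))"
      using assms bt by (intro mult_left_mono mult_right_mono) auto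
    finally show ?thesis by (simp add: algebra_simps)
  qed
  finally show ?thesis .
qed

section \<open>Cut values for an increasing sequence of factors\<close>

locale increasing_sequence =
  fixes p :: "nat \<Rightarrow> nat" and r :: nat
  assumes p_ge_2: "i \<in> {1..r} \<Longrightarrow> 2 \<le> p i"
    and p_mono: "strict_mono_on {1..r} p"
begin

definition q :: "nat \<Rightarrow> real" where
  "q i = 1 - 1 / p i"

text \<open>A cut isolating the class of \<open>{1..k}\<close> has measure \<open>(1 - defect k) / 2\<close>.\<close>

definition defect :: "nat \<Rightarrow> real" where
  "defect k = (1 - 2 * (\<Prod>i=1..k. q i)) * (1 - 2 * (\<Prod>i\<in>{k<..r}. 1 - q i))"

lemma q_bounds:
  assumes "i \<in> {1..r}"
  shows "1 / 2 \<le> q i" "q i < 1" "0 < q i"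
proof -
  have "2 \<le> real (p i)"
    using p_ge_2[OF assms] by simp
  then show "1 / 2 \<le> q i" "q i < 1" "0 < q i"
    by (auto simp: q_def field_simps)
qed

lemma q_mono: "mono_on {1..r} q"
proof (rule mono_onI)
  fix i j assume ij: "i \<in> {1..r}" "j \<in> {1..r}" "i \<le> j"
  then have "p i \<le> p j" "0 < p i"
    using p_mono p_ge_2[of i] by (auto simp: strict_mono_on_leD)
  then show "q i \<le> q j"
    by (simp add: q_def frac_le)
qed

text \<open>The induction step reduces to \<open>p k + 1 \<le> p (k + 1)\<close>, that is, to strict
  growth of integers. This supplies the hypothesis \<open>t \<le> a\<close> of
  \<open>defect_step\<close>.\<close>

lemma inverse_le_prod_q:
  assumes "k \<in> {1..r}"
  shows "1 / p k \<le> (\<Prod>i=1..k. q i)"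
  using assms
proof (induction k)
  case 0
  then show ?case by simp
next
  case (Suc k)
  have pS: "2 \<le> p (Suc k)"
    using p_ge_2 Suc.prems by blast
  show ?case
  proof (cases "k = 0")
    case True
    then show ?thesis
      using pS by (simp add: q_def field_simps)
  next
    case False
    then have k: "k \<in> {1..r}"
      using Suc.prems by auto
    then have "p k < p (Suc k)" "2 \<le> p k"
      using p_mono p_ge_2 Suc.prems by (auto simp: strict_mono_onD)
    then have "real (p k) + 1 \<le> p (Suc k)" "0 < real (p k)"
      by linarith+
    then have "1 / p (Suc k) \<le> 1 / p k * q (Suc k)"
      by (simp add: q_def field_simps)
    also have "\<dots> \<le> (\<Prod>i=1..k. q i) * q (Suc k)"
      using q_bounds[OF Suc.prems] Suc.IH[OF k] by (intro mult_right_mono) auto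
    finally show ?thesis by simp
  qed
qed

text \<open>The condition \<open>k + 3 \<le> r\<close> leaves two indices beyond
  \<open>k + 1\<close>; each contributes a factor at most \<open>t\<close>, whence
  \<open>b \<le> t\<^sup>2\<close> in \<open>defect_step\<close>.\<close>

lemma defect_le_Suc:
  assumes "k + 3 \<le> r"
  shows "defect k \<le> defect (Suc k)"
proof -
  let ?t = "1 - q (Suc k)"
  let ?a = "\<Prod>i=1..Suc k. q i" and ?b = "\<Prod>i\<in>{Suc k<..r}. 1 - q i"
  have k: "Suc k \<in> {1..r}"
    using assms by auto
  have q: "0 \<le> 1 - q i" "1 - q i \<le> 1" "1 - q i \<le> ?t" if "i \<in> {Suc k<..r}" for i
    using q_bounds[of i] that mono_onD[OF q_mono k, of i] by auto
  have "?b = (1 - q (k + 2)) * (1 - q (k + 3)) * (\<Prod>i\<in>{k+3<..r}. 1 - q i)"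
  proof -
    have "{Suc k<..r} = insert (k + 2) (insert (k + 3) {k+3<..r})"
      using assms by auto
    then show ?thesis by simp
  qed
  also have "\<dots> \<le> ?t * ?t * 1"
    using assms q q_bounds[OF k]
    by (intro mult_mono prod_le_1 mult_nonneg_nonneg prod_nonneg) (auto simp: less_imp_le)
  finally have b: "?b \<le> ?t\<^sup>2"
    by (simp add: power2_eq_square)
  have "(1 - 2 * (?a / (1 - ?t))) * (1 - 2 * (?b * ?t)) \<le> (1 - 2 * ?a) * (1 - 2 * ?b)"
  proof (rule defect_step)
    show "?t \<le> ?a"
      using inverse_le_prod_q[OF k] by (simp add: q_def)
    show "0 \<le> ?b"
      using q by (intro prod_nonneg) auto
  qed (use q_bounds[OF k] b in auto)
  moreover have "?a / (1 - ?t) = (\<Prod>i=1..k. q i)"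
    using q_bounds[OF k] by simp
  moreover have "?b * ?t = (\<Prod>i\<in>{k<..r}. 1 - q i)"
  proof -
    have "{k<..r} = insert (Suc k) {Suc k<..r}"
      using assms by auto
    then show ?thesis by simp
  qed
  ultimately show ?thesis
    unfolding defect_def by simp
qed

lemma defect_le:
  assumes "k + 2 \<le> r"
  shows "defect k \<le> defect (r - 2)"
proof -
  have "k \<le> r - 2" using assms by simp
  then show ?thesis
  proof (induction rule: inc_induct)
    case (step m)
    then have "m + 3 \<le> r" by linarith
    then show ?case
      using defect_le_Suc[of m] step.IH by simp
  qed simp
qed

text \<open>Among sets of the same size, \<open>{1..card A}\<close> minimises the up-set and the
  down-set measure simultaneously. The bounds by \<open>1 / 2\<close> keep the factors nonnegative,
  so the two comparisons multiply.\<close>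

lemma defect_ge:
  assumes "A \<subseteq> {1..r}" "(\<Prod>i\<in>A. q i) \<le> 1 / 2" "(\<Prod>i\<in>{1..r} - A. 1 - q i) \<le> 1 / 2"
  shows "(1 - 2 * (\<Prod>i\<in>A. q i)) * (1 - 2 * (\<Prod>i\<in>{1..r} - A. 1 - q i)) \<le> defect (card A)"
proof -
  let ?k = "card A"
  have k: "?k \<le> r"
    using card_mono[OF _ assms(1)] by simp
  have fin: "finite A"
    using assms finite_subset by blast
  have a: "(\<Prod>i=1..?k. q i) \<le> (\<Prod>i\<in>A. q i)"
    using q_mono q_bounds assms by (intro prod_atLeastAtMost_card_le) (auto simp: less_imp_le)
  have p: "(\<Prod>i=1..?k. real (p i)) \<le> (\<Prod>i\<in>A. real (p i))"
    using p_mono assms by (intro prod_atLeastAtMost_card_le[of r])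
      (auto simp: mono_on_def strict_mono_on_leD)
  have pos: "0 < (\<Prod>i\<in>S. real (p i))" if "S \<subseteq> {1..r}" for S
    using that p_ge_2 by (intro prod_pos) (force simp: subset_iff)
  \<comment> \<open>Passing to the complementary product gives an expression increasing in the
    \<open>p i\<close> with \<open>i\<close> in \<open>S\<close>, to which the rearrangement bound
    applies.\<close>
  have eq: "(\<Prod>i\<in>{1..r} - S. 1 - q i) = (\<Prod>i\<in>S. real (p i)) / (\<Prod>i=1..r. real (p i))" if "S \<subseteq> {1..r}" for S
  proof -
    have "(\<Prod>i=1..r. real (p i)) = (\<Prod>i\<in>{1..r} - S. real (p i)) * (\<Prod>i\<in>S. real (p i))"
      using that by (intro prod.subset_diff) auto
    then show ?thesis
      using pos[OF that] by (simp add: q_def prod_dividef)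
  qed
  have "{?k<..r} = {1..r} - {1..?k}"
    by auto
  then have b: "(\<Prod>i\<in>{?k<..r}. 1 - q i) \<le> (\<Prod>i\<in>{1..r} - A. 1 - q i)"
    using k p pos[of "{1..r}"] eq[OF assms(1)] eq[of "{1..?k}"] by (simp add: divide_right_mono)
  show ?thesis
    unfolding defect_def using a b assms by (intro mult_mono) auto
qed

text \<open>The case split is on the sign of \<open>1 - 2 * a\<close>. If it is positive,
  \<open>defect (r - 1)\<close> is nonnegative and absorbs the outcome that the complement has
  measure at least \<open>1 / 2\<close>; otherwise the coatom argument applies.\<close>

lemma cross_incomparable_defect:
  assumes r: "2 \<le> r"
    and XY: "X \<subseteq> Pow {1..r}" "Y \<subseteq> Pow {1..r}" "X \<noteq> {}" "Y \<noteq> {}"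
    and incomp: "\<And>A B. A \<in> X \<Longrightarrow> B \<in> Y \<Longrightarrow> \<not> A \<subseteq> B \<and> \<not> B \<subseteq> A"
  shows "1 - 2 * cube_measure q {1..r} (Pow {1..r} - (X \<union> Y)) \<le> max (defect (r - 1)) (defect (r - 2))"
proof -
  let ?m = "cube_measure q {1..r} (Pow {1..r} - (X \<union> Y))"
  define a where "a = (\<Prod>i=1..r-1. q i)"
  have "{r - 1<..r} = {r}"
    using r by auto
  then have defect: "defect (r - 1) = (1 - 2 * a) * (1 - 2 * (1 - q r))"
    by (simp add: defect_def a_def)
  have ins: "{1..r} - {r} = {1..r-1}" "r \<in> {1..r}"
    using r by auto
  show ?thesis
  proof (cases "1 / 2 \<le> a")
    case True
    have "(\<Prod>i=1..r. q i) + (1 - q r) * (1 - (\<Prod>i\<in>{1..r} - {r}. q i)) \<le> ?m"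
    proof (rule cross_incomparable_complement_large[OF _ _ ins(2) _ _ XY incomp])
      show "0 < q i \<and> q i \<le> 1" if "i \<in> {1..r}" for i
        using q_bounds[OF that] by auto
      show "q i \<le> q r" if "i \<in> {1..r}" for i
        using q_mono that ins by (auto simp: mono_on_def)
      show "1 / 2 \<le> prod q ({1..r} - {r})"
        using True unfolding ins a_def .
    qed auto
    moreover have "(\<Prod>i=1..r. q i) = q r * a"
      using prod.remove[of "{1..r}" r q] ins unfolding a_def by simp
    ultimately have "1 - 2 * ?m \<le> defect (r - 1)"
      unfolding defect ins a_def[symmetric] by (simp add: algebra_simps)
    then show ?thesis by simp
  next
    case False
    then have pos: "0 \<le> defect (r - 1)"
      unfolding defect using q_bounds[of r] r by (intro mult_nonneg_nonneg) auto
    have "finite {1..r}" "\<And>i. i \<in> {1..r} \<Longrightarrow> 0 \<le> q i \<and> q i \<le> 1"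
      using q_bounds by (auto simp: less_imp_le)
    then show ?thesis
    proof (rule cross_incomparable_complement[OF _ _ XY incomp])
      assume "1 / 2 \<le> ?m"
      then show ?thesis using pos by auto
    next
      fix A assume A: "A \<subseteq> {1..r}" "A \<noteq> {1..r}" "(\<Prod>i\<in>A. q i) < 1 / 2"
        "(\<Prod>i\<in>{1..r} - A. 1 - q i) < 1 / 2"
        "1 - 2 * ?m \<le> (1 - 2 * (\<Prod>i\<in>A. q i)) * (1 - 2 * (\<Prod>i\<in>{1..r} - A. 1 - q i))"
      then have "1 - 2 * ?m \<le> defect (card A)"
        using defect_ge[of A] by auto
      moreover have "card A < r"
        using psubset_card_mono[of "{1..r}" A] A by auto
      then have "card A = r - 1 \<or> card A + 2 \<le> r" by auto
      then have "defect (card A) \<le> max (defect (r - 1)) (defect (r - 2))"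
        using defect_le[of "card A"] by (auto simp: max.coboundedI2)
      ultimately show ?thesis by linarith
    qed
  qed
qed

end

section \<open>Separations and cyclic groups\<close>

text \<open>One side is the set of vertices reachable from some \<open>u\<close> after symmetrising;
  conversely no path crosses a separation. The empty graph counts as disconnected without having a
  separation.\<close>

lemma not_connected_iff_separation:
  "\<not> Digraph_Component.connected H \<longleftrightarrow> verts H = {} \<or>
     (\<exists>X Y. X \<union> Y = verts H \<and> X \<inter> Y = {} \<and> X \<noteq> {} \<and> Y \<noteq> {} \<and>
       (\<forall>e\<in>arcs H. \<not> (tail H e \<in> X \<and> head H e \<in> Y) \<and> \<not> (tail H e \<in> Y \<and> head H e \<in> X)))"
  (is "?L \<longleftrightarrow> _ \<or> (\<exists>X Y. ?sep X Y)")
proof (cases "verts H = {}")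
  case True
  then show ?thesis
    by (simp add: Digraph_Component.connected_def strongly_connected_def)
next
  case False
  let ?M = "mk_symmetric H"
  have connected: "\<not> ?L \<longleftrightarrow> (\<forall>u\<in>verts H. \<forall>v\<in>verts H. (u, v) \<in> rtrancl_on (verts H) (parcs ?M))"
    using False by (simp add: Digraph_Component.connected_def strongly_connected_def reachable_def)
  have L: "?L" if "?sep X Y" for X Y
  proof (rule ccontr)
    assume "\<not> ?L"
    from that obtain u v where uv: "u \<in> X" "v \<in> Y" by blast
    then have "(u, v) \<in> rtrancl_on (verts H) (parcs ?M)"
      using \<open>\<not> ?L\<close> connected that by blast
    then have "v \<in> X"
    proof (induction rule: rtrancl_on_induct)
      case base
      then show ?case using uv by simp
    next
      case (step y z)
      then show ?case
        using that by (auto simp: parcs_mk_symmetric)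
    qed
    then show False using uv that by blast
  qed
  have sep: "\<exists>X Y. ?sep X Y" if nc: "?L"
  proof -
    obtain u v where uv: "u \<in> verts H" "v \<in> verts H" "(u, v) \<notin> rtrancl_on (verts H) (parcs ?M)"
      using nc connected by blast
    define X where "X = {x \<in> verts H. (u, x) \<in> rtrancl_on (verts H) (parcs ?M)}"
    have "y \<in> X" if "x \<in> X" "y \<in> verts H" "(x, y) \<in> parcs ?M" for x y
      using that unfolding X_def by (auto intro: rtrancl_on_into_rtrancl_on)
    moreover have "(tail H e, head H e) \<in> parcs ?M" "(head H e, tail H e) \<in> parcs ?M" if "e \<in> arcs H" for e
      using that by (auto simp: parcs_mk_symmetric)
    moreover have "u \<in> X" "v \<in> verts H - X" "X \<subseteq> verts H"
      using uv by (auto simp: X_def)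
    ultimately have "?sep X (verts H - X)" by blast
    then show ?thesis by blast
  qed
  show ?thesis
  proof
    assume "?L"
    then show "verts H = {} \<or> (\<exists>X Y. ?sep X Y)"
      by (intro disjI2 sep)
  next
    assume "verts H = {} \<or> (\<exists>X Y. ?sep X Y)"
    then have "\<exists>X Y. ?sep X Y" by (simp only: False simp_thms)
    then show "?L" using L by (elim exE)
  qed
qed

section \<open>Orders and generated subgroups in finite cyclic groups\<close>

locale finite_cyclic_group = group +
  assumes cyclic: "cyclic_group G" and fin: "finite (carrier G)"
begin

lemma cyclic_generator:
  obtains g where "g \<in> carrier G" "ord g = order G" "carrier G = (\<lambda>k::nat. g [^] k) ` {1..order G}"
proof -
  obtain g where g: "g \<in> carrier G" "carrier G = range (\<lambda>k::int. g [^] k)"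
    using cyclic unfolding cyclic_group by blast
  have "generate G {g} = carrier G"
    using g generate_pow[OF g(1)] by auto
  then have ord: "ord g = order G"
    using generate_pow_card[OF g(1)] by (simp add: order_def)
  have "card ((\<lambda>k::nat. g [^] k) ` {1..ord g}) = ord g"
    using card_image[OF ord_inj'[OF g(1)]] by simp
  then have img: "(\<lambda>k::nat. g [^] k) ` {1..order G} = carrier G"
    using g(1) fin ord by (intro card_subset_eq) (auto simp: order_def)
  show ?thesis using that[OF g(1) ord img[symmetric]] .
qed

text \<open>With \<open>n = order G\<close>, the power \<open>g [^] k\<close> of a generator has
  order \<open>n div gcd n k\<close>, so the task is to count the \<open>k\<close> with
  \<open>gcd k n = n div d\<close>.\<close>

lemma card_ord_eq_totient:
  assumes "d dvd order G"
  shows "card {x \<in> carrier G. ord x = d} = totient d"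
proof -
  obtain g where g: "g \<in> carrier G" "ord g = order G" "carrier G = (\<lambda>k::nat. g [^] k) ` {1..order G}"
    using cyclic_generator .
  let ?n = "order G"
  have n: "?n > 0"
    using fin order_gt_0_iff_finite by blast
  obtain m where m: "?n = d * m"
    using assms by (elim dvdE)
  then have d: "d > 0" "m > 0" "?n div d = m" "?n div m = d"
    using n by (auto intro: Nat.gr0I)
  have eq: "?n div gcd ?n k = d \<longleftrightarrow> gcd k ?n = ?n div d" if "k \<in> {1..?n}" for k
  proof -
    obtain e where e: "?n = gcd k ?n * e"
      using gcd_dvd2[of k ?n] by (elim dvdE)
    have c: "0 < gcd k ?n"
      using n by simp
    then have "?n div gcd ?n k = e"
      using e by (metis gcd.commute nonzero_mult_div_cancel_left less_numeral_extra(3))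
    moreover have "e = d \<longleftrightarrow> gcd k ?n = m"
      using e m d(1,2) c by (metis mult.commute mult_cancel1 less_numeral_extra(3))
    ultimately show ?thesis
      using d(3) by simp
  qed
  have "k \<in> {1..?n} \<and> ord (g [^] k) = d \<longleftrightarrow> k \<in> {0<..?n} \<and> gcd k ?n = ?n div d" for k
  proof (cases "k \<in> {1..?n}")
    case True
    then have "ord (g [^] k) = ?n div gcd ?n k"
      using g(1,2) by (simp add: ord_pow_gen)
    then show ?thesis
      using eq[OF True] True by simp
  qed auto
  then have "{k\<in>{1..?n}. ord (g [^] k) = d} = {k\<in>{0<..?n}. gcd k ?n = ?n div d}"
    by simp
  moreover have "{x \<in> carrier G. ord x = d} = (\<lambda>k::nat. g [^] k) ` {k\<in>{1..?n}. ord (g [^] k) = d}"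
    unfolding g(3) by blast
  ultimately have "{x \<in> carrier G. ord x = d} = (\<lambda>k::nat. g [^] k) ` {k\<in>{0<..?n}. gcd k ?n = ?n div d}"
    by simp
  moreover have "inj_on (\<lambda>k::nat. g [^] k) {k\<in>{0<..?n}. gcd k ?n = ?n div d}"
    using ord_inj'[OF g(1)] g(2) by (auto intro: inj_on_subset)
  ultimately have "card {x \<in> carrier G. ord x = d} = card {k\<in>{0<..?n}. gcd k ?n = ?n div d}"
    by (simp add: card_image)
  also have "\<dots> = totient (?n div (?n div d))"
    using n assms by (intro card_gcd_eq_totient) auto
  also have "?n div (?n div d) = d"
    using d by simp
  finally show ?thesis .
qed

text \<open>A cyclic group has one subgroup of each order: \<open>y\<close> is replaced by the power
  \<open>h\<close> of a generator with the same order, for which membership is arithmetic of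
  exponents.\<close>

lemma mem_generate_iff_ord_dvd:
  assumes "x \<in> carrier G" "y \<in> carrier G"
  shows "x \<in> generate G {y} \<longleftrightarrow> ord x dvd ord y"
proof -
  obtain g where g: "g \<in> carrier G" "ord g = order G" "carrier G = (\<lambda>k::nat. g [^] k) ` {1..order G}"
    using cyclic_generator .
  have n: "order G > 0"
    using fin order_gt_0_iff_finite by blast
  obtain m where m: "order G = ord y * m"
    using ord_dvd_group_order[OF assms(2)] by (elim dvdE)
  then have pos: "m > 0" "ord y > 0"
    using n by (auto intro: Nat.gr0I)
  define h where "h = g [^] m"
  have h: "h \<in> carrier G" "ord h = ord y"
    using g(1,2) m pos by (auto simp: h_def ord_pow)
  have gen: "z \<in> generate G {h} \<longleftrightarrow> ord z dvd ord y" if z: "z \<in> carrier G" for z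
  proof
    assume "z \<in> generate G {h}"
    then obtain k :: nat where "z = h [^] k"
      using generate_pow_on_finite_carrier[OF fin h(1)] by blast
    then have "z [^] ord y = h [^] (k * ord y)"
      using h by (simp add: nat_pow_pow)
    then have "z [^] ord y = \<one>"
      using h by (simp add: pow_eq_id)
    then show "ord z dvd ord y"
      using that by (simp add: pow_eq_id)
  next
    assume *: "ord z dvd ord y"
    obtain k :: nat where k: "z = g [^] k"
      using z unfolding g(3) by blast
    have "z [^] ord y = g [^] (k * ord y)"
      using k g(1) by (simp add: nat_pow_pow)
    moreover have "z [^] ord y = \<one>"
      using * that by (simp add: pow_eq_id)
    ultimately have "g [^] (k * ord y) = \<one>" by simp
    then have "m dvd k"
      using g(1,2) m pos by (simp add: pow_eq_id mult.commute)
    then obtain l where "k = m * l" by (elim dvdE)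
    then have "z = h [^] l"
      using k g(1) by (simp add: h_def nat_pow_pow)
    then show "z \<in> generate G {h}"
      using generate_pow_on_finite_carrier[OF fin h(1)] by blast
  qed
  have "generate G {y} \<subseteq> generate G {h}"
    using gen[OF assms(2)] generate_subgroup_incl[of "{y}" "generate G {h}"] h(1)
    by (simp add: generate_is_subgroup)
  moreover have "card (generate G {y}) = card (generate G {h})"
    using generate_pow_card assms(2) h by simp
  moreover have "finite (generate G {h})"
    using fin generate_incl[of "{h}"] h(1) finite_subset by blast
  ultimately have "generate G {y} = generate G {h}"
    by (intro card_subset_eq) auto
  then show ?thesis using gen assms by simp
qed

end

section \<open>Power graphs of cyclic groups of squarefree order\<close>

locale squarefree_cyclic_group = finite_cyclic_group G + increasing_sequence p r
  for G (structure) and p r +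
  assumes prime_p: "i \<in> {1..r} \<Longrightarrow> prime (p i)"
    and order_eq: "order G = (\<Prod>i=1..r. p i)"
begin

definition supp :: "'a \<Rightarrow> nat set" where
  "supp x = {i \<in> {1..r}. p i dvd ord x}"

lemma supp_subset: "supp x \<subseteq> {1..r}"
  by (auto simp: supp_def)

lemma inj_p: "inj_on p {1..r}"
  using p_mono by (rule strict_mono_on_imp_inj_on)

lemma coprime_p:
  assumes "i \<in> {1..r}" "j \<in> {1..r}" "i \<noteq> j"
  shows "coprime (p i) (p j)"
  using assms inj_p prime_p by (metis inj_onD primes_coprime)

lemma p_dvd_prod_iff:
  assumes "A \<subseteq> {1..r}" "i \<in> {1..r}"
  shows "p i dvd (\<Prod>j\<in>A. p j) \<longleftrightarrow> i \<in> A"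
proof
  have fin_A: "finite A"
    using assms finite_subset by blast
  show "i \<in> A" if "p i dvd (\<Prod>j\<in>A. p j)"
  proof -
    have "\<exists>j\<in>A. p i dvd p j"
      using that prime_dvd_prod_iff[OF fin_A prime_p[OF assms(2)], of p] by simp
    then obtain j where "j \<in> A" "p i dvd p j" by blast
    then have "p i = p j" "j \<in> {1..r}"
      using assms prime_p primes_dvd_imp_eq by blast+
    then show "i \<in> A"
      using assms(2) inj_p \<open>j \<in> A\<close> by (auto dest: inj_onD)
  qed
  show "p i dvd (\<Prod>j\<in>A. p j)" if "i \<in> A"
    using that fin_A by (rule dvd_prodI[rotated])
qed

lemma totient_prod_p:
  assumes "A \<subseteq> {1..r}"
  shows "totient (\<Prod>i\<in>A. p i) = (\<Prod>i\<in>A. p i - 1)"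
proof -
  have "pairwise coprime (p ` A)"
  proof (rule pairwiseI)
    fix x y assume "x \<in> p ` A" "y \<in> p ` A" "x \<noteq> y"
    then obtain i j where "x = p i" "y = p j" "i \<in> A" "j \<in> A" "i \<noteq> j" by blast
    then show "coprime x y"
      using assms coprime_p by blast
  qed
  moreover have "inj_on p A"
    using inj_p assms by (rule inj_on_subset)
  ultimately have "totient (\<Prod>i\<in>A. p i) = (\<Prod>i\<in>A. totient (p i))"
    by (rule totient_prod_coprime)
  also have "\<dots> = (\<Prod>i\<in>A. p i - 1)"
    using assms prime_p by (intro prod.cong) (auto simp: totient_prime)
  finally show ?thesis .
qed

text \<open>The order divides a product of distinct primes; those outside \<open>supp x\<close> are
  coprime to it and cancel, while those inside divide it jointly.\<close>

lemma ord_eq_prod_supp: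
  assumes "x \<in> carrier G"
  shows "ord x = (\<Prod>i\<in>supp x. p i)"
proof (rule dvd_antisym)
  have "coprime (ord x) (\<Prod>i\<in>{1..r} - supp x. p i)"
  proof (rule prod_coprime_right)
    fix i assume "i \<in> {1..r} - supp x"
    then have "prime (p i)" "\<not> p i dvd ord x"
      using prime_p by (auto simp: supp_def)
    then show "coprime (ord x) (p i)"
      using prime_imp_coprime coprime_commute by blast
  qed
  moreover have "ord x dvd (\<Prod>i\<in>{1..r} - supp x. p i) * (\<Prod>i\<in>supp x. p i)"
    using ord_dvd_group_order[OF assms] order_eq prod.subset_diff[OF supp_subset[of x], where g = p] by simp
  ultimately show "ord x dvd (\<Prod>i\<in>supp x. p i)"
    by (simp add: coprime_dvd_mult_right_iff)
  have "(\<Prod>i\<in>A. p i) dvd ord x" if "A \<subseteq> supp x" for A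
  proof -
    have "finite A"
      using that supp_subset finite_subset by (metis finite_atLeastAtMost)
    then show ?thesis
      using that
    proof (induction A rule: finite_induct)
      case (insert i A)
      have "coprime (p i) (\<Prod>j\<in>A. p j)"
      proof (rule prod_coprime_right)
        fix j assume "j \<in> A"
        then have "i \<in> {1..r}" "j \<in> {1..r}" "i \<noteq> j"
          using insert.hyps insert.prems supp_subset[of x] by blast+
        then show "coprime (p i) (p j)" by (rule coprime_p)
      qed
      moreover have "p i dvd ord x"
        using insert.prems by (auto simp: supp_def)
      ultimately show ?case
        using insert by (simp add: divides_mult)
    qed simp
  qed
  then show "(\<Prod>i\<in>supp x. p i) dvd ord x" by simp
qed

lemma supp_eq_iff:
  assumes "x \<in> carrier G" "A \<subseteq> {1..r}"
  shows "supp x = A \<longleftrightarrow> ord x = (\<Prod>i\<in>A. p i)"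
proof
  assume "ord x = (\<Prod>i\<in>A. p i)"
  then show "supp x = A"
    using p_dvd_prod_iff[OF assms(2)] assms(2) by (auto simp: supp_def)
qed (use ord_eq_prod_supp[OF assms(1)] in simp)

lemma mem_generate_iff_supp_subset:
  assumes "x \<in> carrier G" "y \<in> carrier G"
  shows "x \<in> generate G {y} \<longleftrightarrow> supp x \<subseteq> supp y"
proof -
  have "ord x dvd ord y" if "supp x \<subseteq> supp y"
    unfolding ord_eq_prod_supp[OF assms(1)] ord_eq_prod_supp[OF assms(2)]
    using that finite_subset[OF supp_subset] by (intro prod_dvd_prod_subset) auto
  moreover have "supp x \<subseteq> supp y" if "ord x dvd ord y"
    using that by (auto simp: supp_def intro: dvd_trans)
  ultimately show ?thesis
    using mem_generate_iff_ord_dvd[OF assms] by blast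
qed

lemma card_supp_eq:
  assumes "A \<subseteq> {1..r}"
  shows "card {x \<in> carrier G. supp x = A} = (\<Prod>i\<in>A. p i - 1)"
proof -
  have "{x \<in> carrier G. supp x = A} = {x \<in> carrier G. ord x = (\<Prod>i\<in>A. p i)}"
    using supp_eq_iff assms by blast
  then show ?thesis
    using card_ord_eq_totient[of "\<Prod>i\<in>A. p i"] assms totient_prod_p[OF assms] order_eq
    by (simp add: prod_dvd_prod_subset)
qed

lemma ex_supp_eq:
  assumes "A \<subseteq> {1..r}"
  obtains x where "x \<in> carrier G" "supp x = A"
proof -
  have "(\<Prod>i\<in>A. p i - 1) > 0"
    using assms p_ge_2 by (intro prod_pos) (force simp: subset_iff)
  then have "{x \<in> carrier G. supp x = A} \<noteq> {}"
    using card_supp_eq[OF assms] by force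
  then show ?thesis using that by blast
qed

text \<open>Distributing the factors \<open>p i\<close> of the order over the weight turns
  \<open>q i\<close> into \<open>p i - 1\<close> and \<open>1 - q i\<close> into 1.\<close>

lemma card_supp_eq_cube_weight:
  assumes "A \<subseteq> {1..r}"
  shows "real (card {x \<in> carrier G. supp x = A}) = order G * cube_weight q {1..r} A"
proof -
  have p: "1 \<le> p i" "0 < real (p i)" if "i \<in> {1..r}" for i
    using p_ge_2[OF that] by auto
  have "(\<Prod>i=1..r. real (p i)) = (\<Prod>i\<in>{1..r} - A. real (p i)) * (\<Prod>i\<in>A. real (p i))"
    using assms by (intro prod.subset_diff) auto
  then have "order G * cube_weight q {1..r} A =
      (\<Prod>i\<in>A. real (p i) * q i) * (\<Prod>i\<in>{1..r} - A. real (p i) * (1 - q i))"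
    by (simp add: order_eq cube_weight_def prod.distrib)
  also have "(\<Prod>i\<in>A. real (p i) * q i) = (\<Prod>i\<in>A. real (p i - 1))"
  proof (rule prod.cong)
    fix i assume "i \<in> A"
    then have "i \<in> {1..r}" using assms by auto
    then show "real (p i) * q i = real (p i - 1)"
      using p[of i] by (simp add: q_def field_simps of_nat_diff)
  qed simp
  also have "(\<Prod>i\<in>{1..r} - A. real (p i) * (1 - q i)) = 1"
    using p by (intro prod.neutral ballI) (auto simp: q_def)
  finally show ?thesis
    using card_supp_eq[OF assms] by simp
qed

lemma card_supp_mem:
  assumes "F \<subseteq> Pow {1..r}"
  shows "real (card {x \<in> carrier G. supp x \<in> F}) = order G * cube_measure q {1..r} F"
proof -
  have "finite F"
    using assms finite_subset by blast
  have "{x \<in> carrier G. supp x \<in> F} = (\<Union>A\<in>F. {x \<in> carrier G. supp x = A})"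
    by auto
  also have "card \<dots> = (\<Sum>A\<in>F. card {x \<in> carrier G. supp x = A})"
    using \<open>finite F\<close> fin by (intro card_UN_disjoint) auto
  also have "real \<dots> = (\<Sum>A\<in>F. order G * cube_weight q {1..r} A)"
    unfolding of_nat_sum using assms by (intro sum.cong card_supp_eq_cube_weight) auto
  finally show ?thesis
    by (simp add: cube_measure_def sum_distrib_left)
qed

section \<open>Vertex cuts of the power graph\<close>

lemma parcs_power_graph_iff:
  "(x, y) \<in> parcs (power_graph G) \<longleftrightarrow>
     x \<in> carrier G \<and> y \<in> carrier G \<and> x \<noteq> y \<and> (supp x \<subseteq> supp y \<or> supp y \<subseteq> supp x)"
  by (auto simp: power_graph_def mem_generate_iff_supp_subset)

text \<open>The predicate minimised in \<open>vertex_connectivity\<close>. It admits sets leaving at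
  most one vertex; \<open>card S + 2 \<le> order G\<close> excludes these below.\<close>

definition vertex_cut :: "'a set \<Rightarrow> bool" where
  "vertex_cut S \<longleftrightarrow> S \<subseteq> carrier G \<and>
     (\<not> Digraph_Component.connected (with_proj (power_graph G) \<restriction> (carrier G - S)) \<or> card (carrier G - S) = 1)"

lemma not_connected_power_graph_iff:
  assumes "R \<subseteq> carrier G"
  shows "\<not> Digraph_Component.connected (with_proj (power_graph G) \<restriction> R) \<longleftrightarrow> R = {} \<or>
    (\<exists>X Y. X \<union> Y = R \<and> X \<inter> Y = {} \<and> X \<noteq> {} \<and> Y \<noteq> {} \<and>
      (\<forall>x\<in>X. \<forall>y\<in>Y. \<not> supp x \<subseteq> supp y \<and> \<not> supp y \<subseteq> supp x))"
proof -
  let ?H = "with_proj (power_graph G) \<restriction> R"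
  have eq: "(\<forall>e\<in>arcs ?H. \<not> (tail ?H e \<in> X \<and> head ?H e \<in> Y) \<and> \<not> (tail ?H e \<in> Y \<and> head ?H e \<in> X)) \<longleftrightarrow>
      (\<forall>x\<in>X. \<forall>y\<in>Y. \<not> supp x \<subseteq> supp y \<and> \<not> supp y \<subseteq> supp x)" (is "?L \<longleftrightarrow> ?S")
    if "X \<union> Y = R" "X \<inter> Y = {}" for X Y
  proof
    assume L: ?L
    show ?S
    proof (intro ballI)
      fix x y assume xy: "x \<in> X" "y \<in> Y"
      then have "x \<in> R" "y \<in> R" "x \<noteq> y"
        using that by auto
      moreover have "(x, y) \<notin> arcs ?H"
        using L xy by fastforce
      ultimately show "\<not> supp x \<subseteq> supp y \<and> \<not> supp y \<subseteq> supp x"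
        using assms by (auto simp: parcs_power_graph_iff)
    qed
  qed (auto simp: parcs_power_graph_iff)
  show ?thesis
    unfolding not_connected_iff_separation induce_subgraph_verts
    by (intro arg_cong2[where f = "(\<or>)"] iff_exI conj_cong refl) (rule eq; assumption)
qed

text \<open>Deleting all elements whose support is properly comparable to \<open>A\<close> separates
  the class of \<open>A\<close> from the elements with incomparable support.\<close>

lemma vertex_cut_isolating_class:
  assumes A: "A \<subseteq> {1..r}" "A \<noteq> {}" "A \<noteq> {1..r}"
  obtains S where "vertex_cut S" "card S + 2 \<le> order G"
    "1 - 2 * (card S / order G) = (1 - 2 * (\<Prod>i\<in>A. q i)) * (1 - 2 * (\<Prod>i\<in>{1..r} - A. 1 - q i))"
proof -
  define a where "a = (\<Prod>i\<in>A. q i)"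
  define b where "b = (\<Prod>i\<in>{1..r} - A. 1 - q i)"
  define U where "U = {B. A \<subseteq> B \<and> B \<subseteq> {1..r}}"
  let ?m = "cube_measure q {1..r}"
  let ?F = "U \<union> Pow A - {A}"
  have F: "?F \<subseteq> Pow {1..r}" and UA: "U \<subseteq> Pow {1..r}" "Pow A \<subseteq> Pow {1..r}" "U \<inter> Pow A = {A}"
    using A by (auto simp: U_def)
  define S where "S = {x \<in> carrier G. supp x \<in> ?F}"
  define X where "X = {x \<in> carrier G. supp x = A}"
  define Y where "Y = {x \<in> carrier G. \<not> supp x \<subseteq> A \<and> \<not> A \<subseteq> supp x}"
  obtain j where j: "j \<in> {1..r}" "j \<notin> A"
    using A by blast
  obtain x where x: "x \<in> X"
    using ex_supp_eq[OF A(1)] unfolding X_def by blast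
  \<comment> \<open>The singleton \<open>{j}\<close> is incomparable to \<open>A\<close> since
    \<open>j\<close> is outside \<open>A\<close> and \<open>A\<close> is nonempty.\<close>
  obtain y where "y \<in> carrier G" "supp y = {j}"
    using ex_supp_eq[of "{j}"] j by blast
  then have y: "y \<in> Y"
    using j A(2) by (auto simp: Y_def)
  have XY: "X \<union> Y = carrier G - S" "X \<inter> Y = {}"
    using supp_subset by (auto simp: X_def Y_def S_def U_def)
  have "\<forall>x\<in>X. \<forall>y\<in>Y. \<not> supp x \<subseteq> supp y \<and> \<not> supp y \<subseteq> supp x"
    by (auto simp: X_def Y_def)
  then have "\<not> Digraph_Component.connected (with_proj (power_graph G) \<restriction> (carrier G - S))"
    using XY x y by (subst not_connected_power_graph_iff) blast+
  then have "vertex_cut S"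
    by (auto simp: vertex_cut_def S_def)
  moreover have "card S + 2 \<le> order G"
  proof -
    have "x \<noteq> y" "insert x (insert y S) \<subseteq> carrier G" "x \<notin> S" "y \<notin> S" "finite S"
      using x y XY fin by (auto simp: S_def)
    then have "card (insert x (insert y S)) \<le> card (carrier G)"
      using fin card_mono by blast
    moreover have "card (insert x (insert y S)) = card S + 2"
      using \<open>x \<noteq> y\<close> \<open>x \<notin> S\<close> \<open>y \<notin> S\<close> \<open>finite S\<close> by simp
    ultimately show ?thesis by (simp add: order_def)
  qed
  moreover have eq: "card S / order G = a + b - 2 * (a * b)"
  proof -
    have "real (card S) = order G * ?m ?F"
      unfolding S_def using F by (rule card_supp_mem)
    \<comment> \<open>The weight \<open>a * b\<close> of \<open>A\<close> is subtracted twice: here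
      because its class survives, next because \<open>A\<close> lies in both \<open>U\<close> and
      \<open>Pow A\<close>.\<close>
    also have "?m ?F = ?m (U \<union> Pow A) - ?m {A}"
      using UA by (intro cube_measure_Diff) auto
    also have "?m (U \<union> Pow A) = ?m U + ?m (Pow A) - ?m {A}"
      using cube_measure_Un_Int[OF _ UA(1,2), of q] UA(3) by simp
    also have "?m U = a"
      unfolding U_def a_def using A by (intro cube_measure_up) auto
    also have "?m (Pow A) = b"
      unfolding b_def using A by (intro cube_measure_Pow) auto
    also have "?m {A} = a * b"
      by (simp add: cube_measure_def cube_weight_def a_def b_def)
    finally show ?thesis
      using \<open>card S + 2 \<le> order G\<close> by simp
  qed
  moreover have "1 - 2 * (card S / order G) = (1 - 2 * a) * (1 - 2 * b)"
    unfolding eq by (simp add: algebra_simps)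
  ultimately show ?thesis
    using that[of S] unfolding a_def b_def by blast
qed

lemma vertex_cut_card_ge:
  assumes "2 \<le> r" "vertex_cut S" "card S + 2 \<le> order G"
  shows "1 - 2 * (card S / order G) \<le> max (defect (r - 1)) (defect (r - 2))"
proof -
  have S: "S \<subseteq> carrier G" "finite S"
    using assms fin finite_subset by (auto simp: vertex_cut_def)
  then have "card (carrier G - S) = order G - card S"
    by (simp add: card_Diff_subset order_def)
  then have "2 \<le> card (carrier G - S)"
    using assms by linarith
  then have "\<not> Digraph_Component.connected (with_proj (power_graph G) \<restriction> (carrier G - S))" "carrier G - S \<noteq> {}"
    using assms unfolding vertex_cut_def by (linarith, force)
  then obtain X Y where XY: "X \<union> Y = carrier G - S" "X \<noteq> {}" "Y \<noteq> {}"
    and incomp: "\<forall>x\<in>X. \<forall>y\<in>Y. \<not> supp x \<subseteq> supp y \<and> \<not> supp y \<subseteq> supp x"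
    using not_connected_power_graph_iff[of "carrier G - S"] by blast
  let ?C = "Pow {1..r} - (supp ` X \<union> supp ` Y)"
  have "1 - 2 * cube_measure q {1..r} ?C \<le> max (defect (r - 1)) (defect (r - 2))"
    using XY incomp supp_subset by (intro cross_incomparable_defect[OF assms(1)]) auto
  moreover have "order G * cube_measure q {1..r} ?C \<le> card S"
  proof -
    \<comment> \<open>\<open>S\<close> need not be a union of classes, but a class with no surviving
      element lies in \<open>S\<close> entirely.\<close>
    have "{x \<in> carrier G. supp x \<in> ?C} \<subseteq> S"
      using XY by blast
    then have "card {x \<in> carrier G. supp x \<in> ?C} \<le> card S"
      using S by (intro card_mono)
    moreover have "real (card {x \<in> carrier G. supp x \<in> ?C}) = order G * cube_measure q {1..r} ?C"
      by (intro card_supp_mem) auto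
    ultimately show ?thesis by linarith
  qed
  then have "cube_measure q {1..r} ?C \<le> card S / order G"
    using assms(3) by (simp add: field_simps)
  ultimately show ?thesis by linarith
qed

text \<open>As \<open>1 - 2 * (c / order G)\<close> decreases in \<open>c\<close>, the larger defect
  belongs to the smaller cut, so \<open>max\<close> becomes \<open>min\<close>.\<close>

lemma vertex_connectivity_eqI:
  assumes r: "3 \<le> r"
    and k: "1 - 2 * (k / order G) = defect (r - 1)"
    and l: "1 - 2 * (l / order G) = defect (r - 2)"
  shows "vertex_connectivity (with_proj (power_graph G)) = min k l"
proof -
  have cut: "\<exists>S. vertex_cut S \<and> card S = c \<and> c + 2 \<le> order G"
    if "1 \<le> m" "m < r" "1 - 2 * (c / order G) = defect m" for m c
  proof -
    have "{1..r} - {1..m} = {m<..r}" "{1..m} \<subseteq> {1..r}" "{1..m} \<noteq> {}" "{1..m} \<noteq> {1..r}"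
      using that by auto
    then obtain S where S: "vertex_cut S" "card S + 2 \<le> order G" "1 - 2 * (card S / order G) = defect m"
      using vertex_cut_isolating_class[of "{1..m}"] unfolding defect_def by metis
    then have "real (card S) / order G = real c / order G" "order G > 0"
      using that(3) by linarith+
    then have "card S = c" by simp
    then show ?thesis using S by blast
  qed
  \<comment> \<open>\<open>3 \<le> r\<close> makes \<open>{1..r - 2}\<close> nonempty, so its class
    can be isolated.\<close>
  have m: "1 \<le> r - 1" "r - 1 < r" "1 \<le> r - 2" "r - 2 < r"
    using r by linarith+
  obtain S where S: "vertex_cut S" "card S = k" "k + 2 \<le> order G"
    using cut[OF m(1,2) k] by blast
  obtain T where T: "vertex_cut T" "card T = l" "l + 2 \<le> order G"
    using cut[OF m(3,4) l] by blast
  have "vertex_connectivity (with_proj (power_graph G)) = (LEAST c. \<exists>S. vertex_cut S \<and> card S = c)"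
    by (auto simp: vertex_connectivity_def vertex_cut_def power_graph_def intro!: arg_cong[where f = Least])
  also have "\<dots> = min k l"
  proof (rule Least_equality)
    show "\<exists>S. vertex_cut S \<and> card S = min k l"
      using S T by (auto simp: min_def)
    fix c assume "\<exists>S. vertex_cut S \<and> card S = c"
    then obtain R where R: "vertex_cut R" "card R = c" by blast
    show "min k l \<le> c"
    proof (cases "c + 2 \<le> order G")
      case True
      then have "1 - 2 * (c / order G) \<le> max (1 - 2 * (k / order G)) (1 - 2 * (l / order G))"
        using vertex_cut_card_ge[of R] R r k l by simp
      moreover have "real (order G) > 0"
        using True by simp
      ultimately show ?thesis
        by (auto simp: max_def divide_le_cancel split: if_splits)
    next
      \<comment> \<open>A set leaving at most one vertex is larger than \<open>S\<close>, which
        leaves at least two.\<close>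
      case False
      then show ?thesis using S(3) by simp
    qed
  qed
  finally show ?thesis .
qed

section \<open>Closed forms of the two optimal cuts\<close>

lemma defect_eq:
  assumes "m \<le> r"
  shows "defect m = (1 - 2 * (totient (\<Prod>i=1..m. p i) / (\<Prod>i=1..m. p i))) * (1 - 2 / (\<Prod>i\<in>{m<..r}. p i))"
proof -
  have "(\<Prod>i=1..m. q i) = (\<Prod>i=1..m. real (p i - 1) / real (p i))"
  proof (rule prod.cong)
    fix i assume "i \<in> {1..m}"
    then have "2 \<le> p i" using p_ge_2 assms by auto
    then show "q i = real (p i - 1) / real (p i)"
      by (simp add: q_def field_simps of_nat_diff)
  qed simp
  then have "(\<Prod>i=1..m. q i) = totient (\<Prod>i=1..m. p i) / (\<Prod>i=1..m. p i)"
    using assms totient_prod_p[of "{1..m}"] by (simp add: prod_dividef)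
  moreover have "(\<Prod>i\<in>{m<..r}. 1 - q i) = 1 / (\<Prod>i\<in>{m<..r}. p i)"
    by (simp add: q_def prod_dividef)
  ultimately show ?thesis
    by (simp add: defect_def)
qed

lemma totient_mult_p:
  assumes "A \<subseteq> {1..r}" "i \<in> {1..r}" "i \<notin> A"
  shows "totient ((\<Prod>j\<in>A. p j) * p i) = totient (\<Prod>j\<in>A. p j) * (p i - 1)"
proof -
  have "coprime (\<Prod>j\<in>A. p j) (p i)"
    using assms coprime_p by (intro prod_coprime_left) (metis subsetD)
  then show ?thesis
    using assms prime_p by (simp add: totient_mult_coprime totient_prime)
qed

text \<open>\<open>alpha\<close> counts the cut isolating the class of \<open>{1..r-1}\<close>: the
  generators of the group, and the nongenerators of its subgroup of order \<open>P\<close>.\<close>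

lemma alpha_eq:
  assumes r: "2 \<le> r"
  shows "1 - 2 * (alpha p r (order G) / order G) = defect (r - 1)"
proof -
  define P where "P = (\<Prod>i=1..r-1. p i)"
  define t where "t = p r"
  have ins: "{1..r} = insert r {1..r-1}" "{r-1<..r} = {r}" "r \<in> {1..r}" "r \<notin> {1..r-1}" "{1..r-1} \<subseteq> {1..r}"
    using r by auto
  have "2 \<le> t"
    using p_ge_2[OF ins(3)] by (simp add: t_def)
  have prod: "(\<Prod>i=1..r. p i) = P * t"
    unfolding ins(1) P_def t_def using prod.insert[OF _ ins(4), of p] by (simp add: mult.commute)
  have n: "order G = P * t" "0 < P"
    using prod fin order_gt_0_iff_finite order_eq by auto
  have tot: "totient (P * t) = totient P * (t - 1)"
    unfolding P_def t_def using ins by (intro totient_mult_p)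
  have "real (alpha p r (order G)) = real (totient P) * (real t - 1) + (real P - real (totient P))"
    unfolding alpha_def prod P_def[symmetric] n(1) tot
    using \<open>2 \<le> t\<close> n(2) totient_le[of P] by (simp add: of_nat_diff)
  moreover have "defect (r - 1) = (1 - 2 * (totient P / P)) * (1 - 2 / real t)"
    using ins(2) by (simp add: defect_eq P_def t_def)
  ultimately show ?thesis
    using \<open>2 \<le> t\<close> n by (simp add: field_simps)
qed

text \<open>\<open>gamma\<close> counts the cut isolating the class of \<open>{1..r-2}\<close>: the
  three proper supersets give the totients of \<open>n\<close>, \<open>P * s\<close> and
  \<open>P * t\<close>, the proper subsets give \<open>P - totient P\<close>.\<close>

lemma gamma_eq:
  assumes r: "2 \<le> r"
  shows "1 - 2 * (gamma p r (order G) / order G) = defect (r - 2)"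
proof -
  define P where "P = (\<Prod>i=1..r-2. p i)"
  define s where "s = p (r - 1)"
  define t where "t = p r"
  have ins: "{1..r-1} = insert (r - 1) {1..r-2}" "{1..r} = insert r {1..r-1}" "{r-2<..r} = {r-1, r}"
    "r \<in> {1..r}" "r - 1 \<in> {1..r}" "r \<notin> {1..r-1}" "r \<notin> {1..r-2}" "r - 1 \<notin> {1..r-2}"
    "{1..r-1} \<subseteq> {1..r}" "{1..r-2} \<subseteq> {1..r}" "r - 1 \<noteq> r"
    using r by auto
  have "2 \<le> s" "2 \<le> t"
    using p_ge_2[OF ins(4)] p_ge_2[OF ins(5)] by (simp_all add: s_def t_def)
  have prod1: "(\<Prod>i=1..r-1. p i) = P * s"
    unfolding ins(1) P_def s_def using prod.insert[OF _ ins(8), of p] by (simp add: mult.commute)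
  have prod: "(\<Prod>i=1..r. p i) = P * s * t"
    using prod.insert[OF _ ins(6), of p] unfolding prod1 ins(2)[symmetric] by (simp add: t_def)
  have n: "order G = P * s * t" "0 < P"
    using prod fin order_gt_0_iff_finite order_eq by auto
  have tot_s: "totient (P * s) = totient P * (s - 1)"
    unfolding P_def s_def using ins by (intro totient_mult_p)
  have tot_t: "totient (P * t) = totient P * (t - 1)"
    unfolding P_def t_def using ins by (intro totient_mult_p)
  have "totient (P * s * t) = totient (P * s) * (t - 1)"
    unfolding prod1[symmetric] t_def using ins by (intro totient_mult_p)
  then have tot: "totient (P * s * t) = totient P * (s - 1) * (t - 1)"
    unfolding tot_s .
  have "real (gamma p r (order G)) = real (totient P) * (real s - 1) * (real t - 1) +
      (real (totient P) * (real s - 1) + real (totient P) * (real t - 1) + (real P - real (totient P)))"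
    unfolding gamma_def prod prod1 P_def[symmetric] t_def[symmetric] n(1) tot tot_s tot_t
    using \<open>2 \<le> s\<close> \<open>2 \<le> t\<close> n(2) totient_le[of P] by (simp add: of_nat_diff)
  moreover have "defect (r - 2) = (1 - 2 * (totient P / P)) * (1 - 2 / (real s * real t))"
    using ins(3,11) by (simp add: defect_eq P_def s_def t_def)
  ultimately show ?thesis
    using \<open>2 \<le> s\<close> \<open>2 \<le> t\<close> n by (simp add: field_simps)
qed

end

theorem theorem1p3:
  fixes G :: "('a, 'b) monoid_scheme" and p :: "nat \<Rightarrow> nat" and r n :: nat
  assumes "r \<ge> 3"
    and "\<forall>i\<in>{1..r}. prime (p i)"
    and "strict_mono_on {1..r} p"
    and "n = (\<Prod>i=1..r. p i)"
    and "group G" and "cyclic_group G" and "order G = n"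
  shows "vertex_connectivity (with_proj (power_graph G)) = min (alpha p r n) (gamma p r n)"
proof -
  interpret group G by fact
  \<comment> \<open>An infinite carrier would have order 0 by the convention for
    \<open>card\<close>, so a positive product of primes forces finiteness.\<close>
  have "order G > 0"
    using assms by (auto intro!: prod_pos prime_gt_0_nat)
  then have "finite (carrier G)"
    by (simp add: order_gt_0_iff_finite)
  then interpret squarefree_cyclic_group G p r
    using assms prime_ge_2_nat by unfold_locales auto
  show ?thesis
    using vertex_connectivity_eqI[OF assms(1) alpha_eq gamma_eq] assms by simp
qed

end
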